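(* Let $N\ge2$ and consider the dual boundary driven exclusion process $(\xi_t)_{t\ge 0}$ on the homogeneous segment, i.e. with $\omega_{x,y}=\mathbf 1_{\{|x-y|=1\}}$ for all $x,y\in[N-1]$ and $\omega_L=\omega_R=1$. Then for all $n$ and all integers $1\le x_1<\dots<x_n\le N-1$, $$\hat{\mathbb P}_{\{x_1,\dots,x_n\}}\big(\xi_\infty(N)=n\big)=\prod_{i=1}^n\frac{x_i-(i-1)}{N-(i-1)}.$$
   Context: $[N-1]:=\{1,\dots,N-1\}$. The dual boundary driven (symmetric) exclusion process with symmetric conductances $\omega_{x,y}$ on the edges $\{x,y\}\in E$ of a connected graph on $[N-1]$ (here the edges are the pairs with $|x-y|=1$) and $\omega_L,\omega_R>0$ is the Markov process $(\xi_t)_{t\ge0}$ on $\hat{\mathcal X}=\mathbb N_0^{\{0\}}\times\{0,1\}^{[N-1]}\times\mathbb N_0^{\{N\}}$ with generator $$\hat{\mathcal L}f(\xi)=\sum_{\{x,y\}\in E}\omega_{x,y}\big\{\xi(x)(1-\xi(y))(f(\xi^{x,y})-f(\xi))+\xi(y)(1-\xi(x))(f(\xi^{y,x})-f(\xi))\big\}$$ $$+\ \omega_L\,\xi(1)(f(\xi^{1,0})-f(\xi))+\omega_R\,\xi(N-1)(f(\xi^{N-1,N})-f(\xi)),$$ where $\xi^{x,y}$ is $\xi$ with one particle moved from $x$ to $y$. Thus particles in the bulk $[N-1]$ follow the exclusion dynamics and the sites $0,N$ are absorbing. For $J\subset[N-1]$, $\hat{\mathbb P}_J$ is the law of the process started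 from $\xi_0(x)=\mathbf 1_{\{x\in J\}}$. All particles are eventually absorbed almost surely, and $\xi_\infty:=\lim_{t\to\infty}\xi_t$; $\xi_\infty(N)$ is the number of particles absorbed at $N$. *)

theory Defs
  imports "HOL-Probability.Probability"
begin

section \<open>Markov processes on a countable discrete state space\<close>

text \<open>
  \<open>P t x\<close> is the distribution at time \<open>t\<close> of the process started from \<open>x\<close>. All conditions concern
  \<open>t \<ge> 0\<close> and \<open>x \<in> S\<close> only.
\<close>

definition transition_semigroup :: "'s set \<Rightarrow> (real \<Rightarrow> 's \<Rightarrow> 's pmf) \<Rightarrow> bool" where
  "transition_semigroup S P \<longleftrightarrow>
     (\<forall>x\<in>S. \<forall>t\<ge>0. set_pmf (P t x) \<subseteq> S) \<and>
     (\<forall>x\<in>S. P 0 x = return_pmf x) \<and>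
     (\<forall>x\<in>S. \<forall>s\<ge>0. \<forall>t\<ge>0. P (s + t) x = bind_pmf (P s x) (P t))"

text \<open>
  \<open>L\<close> is the strong (sup-norm) generator on the space of all bounded functions on \<open>S\<close>; this is the
  appropriate domain for generators whose total jump rates are bounded.
\<close>

definition has_generator ::
  "'s set \<Rightarrow> (real \<Rightarrow> 's \<Rightarrow> 's pmf) \<Rightarrow> (('s \<Rightarrow> real) \<Rightarrow> 's \<Rightarrow> real) \<Rightarrow> bool" where
  "has_generator S P L \<longleftrightarrow>
     (\<forall>f. bounded (f ` S) \<longrightarrow>
        uniform_limit S (\<lambda>t x. (measure_pmf.expectation (P t x) f - f x) / t) (L f) (at_right 0))"

definition past :: "'a measure \<Rightarrow> 's set \<Rightarrow> (real \<Rightarrow> 'a \<Rightarrow> 's) \<Rightarrow> real \<Rightarrow> 'a measure" where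
  "past M S X s = sigma (space M) {X r -` A \<inter> space M | r A. 0 \<le> r \<and> r \<le> s \<and> A \<subseteq> S}"

text \<open>Only times \<open>t \<ge> 0\<close> matter. Right-continuity is with respect to the discrete topology on \<open>S\<close>.\<close>

locale markov_process = prob_space M for M :: "'a measure" +
  fixes S :: "'s set" and P :: "real \<Rightarrow> 's \<Rightarrow> 's pmf"
    and X :: "real \<Rightarrow> 'a \<Rightarrow> 's" and x\<^sub>0 :: 's
  assumes countable_states: "countable S"
    and semigroup: "transition_semigroup S P"
    and measurable: "\<And>t. 0 \<le> t \<Longrightarrow> X t \<in> measurable M (count_space S)"
    and start: "x\<^sub>0 \<in> S" "AE \<omega> in M. X 0 \<omega> = x\<^sub>0"
    and markov: "\<And>s t f. 0 \<le> s \<Longrightarrow> 0 \<le> t \<Longrightarrow> bounded (f ` S) \<Longrightarrow>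
      AE \<omega> in M. real_cond_exp M (past M S X s) (\<lambda>\<omega>. f (X (s + t) \<omega>)) \<omega>
                = measure_pmf.expectation (P t (X s \<omega>)) f"
    and right_continuous: "\<And>\<omega> t. \<omega> \<in> space M \<Longrightarrow> 0 \<le> t \<Longrightarrow>
      eventually (\<lambda>s. X s \<omega> = X t \<omega>) (at_right t)"


section \<open>The dual boundary driven exclusion process\<close>

type_synonym config = "nat \<Rightarrow> nat"

definition bulk :: "nat \<Rightarrow> nat set" where
  "bulk N = {1..N - 1}"

text \<open>Configurations live on the sites \<open>0,\<dots>,N\<close> and are extended by \<open>0\<close> beyond \<open>N\<close>.\<close>

definition dual_configs :: "nat \<Rightarrow> config set" where
  "dual_configs N = {\<xi>. (\<forall>x\<in>bulk N. \<xi> x \<le> 1) \<and> (\<forall>x>N. \<xi> x = 0)}"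

text \<open>
  The truncated subtraction is harmless: in the generator below this is only relevant when \<open>\<xi> x \<ge> 1\<close>,
  all other occurrences carrying the factor \<open>\<xi> x = 0\<close>.
\<close>

definition move :: "config \<Rightarrow> nat \<Rightarrow> nat \<Rightarrow> config" where
  "move \<xi> x y = (\<lambda>z. if z = x then \<xi> x - 1 else if z = y then \<xi> y + 1 else \<xi> z)"

definition segment_edges :: "nat \<Rightarrow> nat set set" where
  "segment_edges N = {{x, y} | x y. x \<in> bulk N \<and> y \<in> bulk N \<and> \<bar>int x - int y\<bar> = 1}"

text \<open>
  For symmetric \<open>\<omega>\<close> the summand is symmetric in \<open>x\<close> and \<open>y\<close>; the condition \<open>x < y\<close> makes every
  unordered edge count once.
\<close>

definition dual_generator ::
  "nat \<Rightarrow> nat set set \<Rightarrow> (nat \<Rightarrow> nat \<Rightarrow> real) \<Rightarrow> real \<Rightarrow> real \<Rightarrow> (config \<Rightarrow> real) \<Rightarrow> config \<Rightarrow> real" where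
  "dual_generator N E \<omega> \<omega>L \<omega>R f \<xi> =
     (\<Sum>(x, y) \<in> {(x, y). x \<in> bulk N \<and> y \<in> bulk N \<and> x < y \<and> {x, y} \<in> E}.
        \<omega> x y * (real (\<xi> x) * (1 - real (\<xi> y)) * (f (move \<xi> x y) - f \<xi>)
               + real (\<xi> y) * (1 - real (\<xi> x)) * (f (move \<xi> y x) - f \<xi>)))
     + \<omega>L * real (\<xi> 1) * (f (move \<xi> 1 0) - f \<xi>)
     + \<omega>R * real (\<xi> (N - 1)) * (f (move \<xi> (N - 1) N) - f \<xi>)"

definition indicator_config :: "nat set \<Rightarrow> config" where
  "indicator_config J = (\<lambda>x. if x \<in> J then 1 else 0)"

text \<open>\<open>\<xi>\<close> is, on the probability space \<open>M\<close>, a realisation of the dual process started from \<open>J\<close>.\<close>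

definition dual_exclusion_process ::
  "nat \<Rightarrow> nat set set \<Rightarrow> (nat \<Rightarrow> nat \<Rightarrow> real) \<Rightarrow> real \<Rightarrow> real \<Rightarrow> nat set \<Rightarrow>
   'a measure \<Rightarrow> (real \<Rightarrow> 'a \<Rightarrow> config) \<Rightarrow> bool" where
  "dual_exclusion_process N E \<omega> \<omega>L \<omega>R J M \<xi> \<longleftrightarrow>
     (\<exists>P. markov_process M (dual_configs N) P \<xi> (indicator_config J) \<and>
          has_generator (dual_configs N) P (dual_generator N E \<omega> \<omega>L \<omega>R))"

text \<open>
  Sitewise limits; on \<open>dual_configs N\<close>, where only finitely many sites matter, sitewise convergence is
  convergence in the discrete topology. Where a limit does not exist, \<open>Lim\<close> is a fixed but
  unspecified number.
\<close>

definition final_config :: "(real \<Rightarrow> 'a \<Rightarrow> config) \<Rightarrow> 'a \<Rightarrow> config" where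
  "final_config \<xi> \<omega> = (\<lambda>x. Lim at_top (\<lambda>t. \<xi> t \<omega> x))"

end

theory Submission
  imports Defs "HOL-Real_Asymp.Real_Asymp"
begin

text \<open>
  The right-hand side extends to a function \<open>h\<close> (\<open>all_right\<close>) of all configurations: \<open>h \<xi>\<close> is \<open>0\<close> if a
  particle sits at \<open>0\<close>, and otherwise the product of \<open>(x\<^sub>i - (i - 1)) / (N - (i - 1))\<close> over the positions
  \<open>x\<^sub>1 < x\<^sub>2 < \<dots>\<close> of the particles in the bulk. This function is bounded and harmonic, \<open>L h = 0\<close>
  (\<open>generator_all_right\<close>). Indeed, if all jumps were allowed, \<open>h\<close> would be harmonic because it is affine
  in every position; exclusion suppresses exactly two jumps for each pair of neighbouring particles, and
  the shifts \<open>i - 1\<close> make the increments of these two jumps cancel. At the boundary, the factor of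
  the first particle would be \<open>0\<close> at site \<open>0\<close> and that of the last one would be \<open>1\<close> at site \<open>N\<close>, in
  agreement with the values of \<open>h\<close> after absorption.

  Consequently the expectation of \<open>h\<close> along the process is constant in time. The total number \<open>n\<close> of
  particles is conserved, and almost surely the bulk becomes empty, from which moment on the process
  stands still. In a configuration with empty bulk, \<open>h\<close> is the indicator that no particle is at \<open>0\<close>, that
  is, that all \<open>n\<close> of them are at \<open>N\<close>. So \<open>h\<close> at the initial configuration is the probability in
  question (\<open>prob_all_right\<close>).

  All that has to be known about the semigroup comes from one comparison principle,
  \<open>expectation_decay\<close>: if \<open>L f \<le> - c * f\<close> with \<open>c \<ge> 0\<close>, then \<open>P t f \<le> exp (- c * t) * f\<close>. With \<open>c = 0\<close>
  it makes \<open>h\<close> and the particle number martingales and shows that configurations with empty bulk are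
  absorbing; with \<open>c = 2 / N\<^sup>2\<close> and \<open>f\<close> the potential \<open>\<Sum>x. \<xi> x * x * (N - x)\<close> it shows that the bulk
  empties.
\<close>

section \<open>Comparison with the generator\<close>

text \<open>
  Boundedness is required on the support only, while \<open>integral_bind\<close> asks for it everywhere; cutting
  \<open>f\<close> off outside the support bridges the difference.
\<close>
lemma expectation_bind_pmf:
  fixes f :: "'s \<Rightarrow> real"
  assumes "\<And>y. y \<in> set_pmf (bind_pmf p K) \<Longrightarrow> \<bar>f y\<bar> \<le> B"
  shows "measure_pmf.expectation (bind_pmf p K) f
       = measure_pmf.expectation p (\<lambda>y. measure_pmf.expectation (K y) f)"
proof -
  define g where "g = (\<lambda>y. if \<bar>f y\<bar> \<le> B then f y else 0)"
  have gB: "\<bar>g y\<bar> \<le> \<bar>B\<bar>" for y by (auto simp: g_def)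
  have "measure_pmf.expectation (bind_pmf p K) f = measure_pmf.expectation (bind_pmf p K) g"
    by (intro integral_cong_AE) (use assms in \<open>auto simp: AE_measure_pmf_iff g_def\<close>)
  also have "\<dots> = measure_pmf.expectation p (\<lambda>y. measure_pmf.expectation (K y) g)"
    unfolding measure_pmf_bind
    by (rule integral_bind[where K = "count_space UNIV" and B = "\<bar>B\<bar>" and B' = 1])
       (use gB in \<open>auto simp: measure_pmf.finite_measure_axioms measure_pmf.emeasure_space_1
          measure_pmf_in_subprob_algebra\<close>)
  also have "\<dots> = measure_pmf.expectation p (\<lambda>y. measure_pmf.expectation (K y) f)"
  proof (intro integral_cong_AE)
    have "measure_pmf.expectation (K y) g = measure_pmf.expectation (K y) f" if "y \<in> set_pmf p" for y
      by (intro integral_cong_AE) (use that assms in \<open>auto simp: AE_measure_pmf_iff g_def\<close>)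
    then show "AE y in measure_pmf p.
        measure_pmf.expectation (K y) g = measure_pmf.expectation (K y) f"
      by (auto simp: AE_measure_pmf_iff)
  qed auto
  finally show ?thesis .
qed

lemma bounded_image_obtain:
  fixes f :: "'s \<Rightarrow> real"
  assumes "bounded (f ` S)"
  obtains B where "0 \<le> B" "\<And>x. x \<in> S \<Longrightarrow> \<bar>f x\<bar> \<le> B"
proof -
  from assms obtain B where "\<forall>y\<in>f ` S. norm y \<le> B" by (auto simp: bounded_iff)
  then show ?thesis by (intro that[of "\<bar>B\<bar>"]) (auto intro: order.trans)
qed

lemma integrable_pmf_bounded_on:
  fixes f :: "'s \<Rightarrow> real"
  assumes "bounded (f ` S)" "set_pmf p \<subseteq> S"
  shows "integrable (measure_pmf p) f"
proof -
  obtain B where "\<And>x. x \<in> S \<Longrightarrow> \<bar>f x\<bar> \<le> B" using bounded_image_obtain[OF assms(1)] by metis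
  then show ?thesis
    by (intro measure_pmf.integrable_const_bound[where B = B])
       (use assms(2) in \<open>auto simp: AE_measure_pmf_iff\<close>)
qed

lemma bounded_expectation_image:
  fixes f :: "'s \<Rightarrow> real"
  assumes f: "bounded (f ` S)" and p: "\<And>x. x \<in> S \<Longrightarrow> set_pmf (p x) \<subseteq> S"
  shows "bounded ((\<lambda>x. measure_pmf.expectation (p x) f) ` S)"
proof -
  obtain B where B: "\<And>x. x \<in> S \<Longrightarrow> \<bar>f x\<bar> \<le> B" using bounded_image_obtain[OF f] by metis
  have "\<bar>measure_pmf.expectation (p x) f\<bar> \<le> B" if x: "x \<in> S" for x
  proof -
    have "\<bar>measure_pmf.expectation (p x) f\<bar> \<le> measure_pmf.expectation (p x) (\<lambda>y. \<bar>f y\<bar>)"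
      by (rule integral_abs_bound)
    also have "\<dots> \<le> B"
      by (rule measure_pmf.integral_le_const)
         (use B p[OF x] f in \<open>auto simp: AE_measure_pmf_iff
            intro!: integrable_abs integrable_pmf_bounded_on[OF f]\<close>)
    finally show ?thesis .
  qed
  then show ?thesis by (auto simp: bounded_iff intro!: exI[of _ B])
qed

lemma semigroup_expectation_add:
  fixes f :: "'s \<Rightarrow> real"
  assumes "transition_semigroup S P" "bounded (f ` S)" "x \<in> S" "0 \<le> s" "0 \<le> t"
  shows "measure_pmf.expectation (P (s + t) x) f
       = measure_pmf.expectation (P s x) (\<lambda>y. measure_pmf.expectation (P t y) f)"
proof -
  obtain B where B: "\<And>x. x \<in> S \<Longrightarrow> \<bar>f x\<bar> \<le> B" using bounded_image_obtain[OF assms(2)] by metis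
  have eq: "P (s + t) x = bind_pmf (P s x) (P t)"
    using assms(1,3-5) by (simp add: transition_semigroup_def)
  have sub: "set_pmf (P (s + t) x) \<subseteq> S"
    using assms(1,3-5) unfolding transition_semigroup_def by (meson add_nonneg_nonneg)
  show ?thesis
    unfolding eq by (rule expectation_bind_pmf[where B = B]) (use sub[unfolded eq] B in blast)
qed

text \<open>
  Over a short time \<open>s\<close> the generator gives \<open>P s f \<le> (1 - c * s) * f + \<epsilon> * s\<close>, uniformly on \<open>S\<close>.
  Composing \<open>k\<close> such steps of length \<open>t / k\<close> costs a total error of at most \<open>\<epsilon> * t\<close>, because each
  factor \<open>1 - c * s\<close> lies between \<open>0\<close> and \<open>1\<close>; now let \<open>k \<rightarrow> \<infinity>\<close> and then \<open>\<epsilon> \<rightarrow> 0\<close>. In this way no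
  differential equation for \<open>t \<mapsto> P t f\<close> has to be set up or solved. The case \<open>c = 0\<close>, applied to \<open>f\<close>
  and to \<open>-f\<close>, says that \<open>L f = 0\<close> makes \<open>P t f = f\<close>.
\<close>
lemma expectation_decay:
  fixes f :: "'s \<Rightarrow> real"
  assumes sg: "transition_semigroup S P" and gen: "has_generator S P L"
    and f: "bounded (f ` S)" and "0 \<le> c" and Lf: "\<And>x. x \<in> S \<Longrightarrow> L f x \<le> - c * f x"
    and t: "0 \<le> t" and x: "x \<in> S"
  shows "measure_pmf.expectation (P t x) f \<le> exp (- c * t) * f x"
proof (cases "t = 0")
  case True
  then show ?thesis using sg x by (simp add: transition_semigroup_def)
next
  case False
  with t have t: "0 < t" by simp
  let ?E = "\<lambda>s y. measure_pmf.expectation (P s y) f"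
  have sub: "set_pmf (P s y) \<subseteq> S" if "y \<in> S" "0 \<le> s" for y s
    using sg that by (auto simp: transition_semigroup_def)
  have bound: "?E t x \<le> exp (- c * t) * f x + \<epsilon> * t" if \<epsilon>: "0 < \<epsilon>" for \<epsilon>
  proof (rule tendsto_lowerbound)
    have "((\<lambda>k. (1 + (- c * t) / real k) ^ k) \<longlonglongrightarrow> exp (- c * t))"
      by (rule tendsto_exp_limit_sequentially)
    then show "(\<lambda>k. (1 + (- c * t) / real k) ^ k * f x + \<epsilon> * t)
        \<longlonglongrightarrow> exp (- c * t) * f x + \<epsilon> * t"
      by (intro tendsto_intros)
    have "\<forall>\<^sub>F s in at_right 0. \<forall>y\<in>S. dist ((?E s y - f y) / s) (L f y) < \<epsilon>"
      using gen f \<epsilon> by (auto simp: has_generator_def uniform_limit_iff)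
    then obtain \<delta> where \<delta>: "0 < \<delta>"
      "\<And>s y. 0 < s \<Longrightarrow> s < \<delta> \<Longrightarrow> y \<in> S \<Longrightarrow> dist ((?E s y - f y) / s) (L f y) < \<epsilon>"
      by (auto simp: eventually_at_right_field)
    have "\<forall>\<^sub>F k in sequentially. t / real k < \<delta>"
      using \<open>0 < \<delta>\<close> by real_asymp
    moreover have "\<forall>\<^sub>F k in sequentially. c * t / real k < 1"
      by real_asymp
    ultimately show "\<forall>\<^sub>F k in sequentially.
        ?E t x \<le> (1 + (- c * t) / real k) ^ k * f x + \<epsilon> * t"
      using eventually_gt_at_top[of 0]
    proof eventually_elim
      case (elim k)
      define s where "s = t / real k"
      have s: "0 < s" "s < \<delta>" "c * s \<le> 1" "real k * s = t"
        using elim t by (auto simp: s_def)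
      have step: "?E s y \<le> (1 - c * s) * f y + \<epsilon> * s" if "y \<in> S" for y
      proof -
        have "(?E s y - f y) / s < - c * f y + \<epsilon>"
          using \<delta>(2)[OF s(1,2) that] Lf[OF that] by (auto simp: dist_real_def)
        then have "?E s y - f y < (- c * f y + \<epsilon>) * s"
          using s(1) by (simp add: pos_divide_less_eq)
        then show ?thesis by (simp add: algebra_simps)
      qed
      have iter: "?E (real j * s) y \<le> (1 - c * s) ^ j * f y + real j * \<epsilon> * s" if "y \<in> S" for j y
        using that
      proof (induction j arbitrary: y)
        case 0
        then show ?case using sg by (simp add: transition_semigroup_def)
      next
        case (Suc j)
        let ?r = "1 - c * s"
        have r: "0 \<le> ?r ^ j" "?r ^ j \<le> 1"
          using s \<open>0 \<le> c\<close> by (auto intro!: zero_le_power power_le_one)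
        have int: "integrable (measure_pmf (P s y)) f"
          by (rule integrable_pmf_bounded_on[OF f sub]) (use Suc s in auto)
        have "?E (real (Suc j) * s) y = ?E (s + real j * s) y"
          by (simp add: algebra_simps)
        also have "\<dots> = measure_pmf.expectation (P s y) (?E (real j * s))"
          using s by (intro semigroup_expectation_add[OF sg f Suc.prems]) auto
        also have "\<dots> \<le> measure_pmf.expectation (P s y) (\<lambda>z. ?r ^ j * f z + real j * \<epsilon> * s)"
        proof (rule integral_mono_AE)
          show "integrable (measure_pmf (P s y)) (?E (real j * s))"
            by (rule integrable_pmf_bounded_on[OF bounded_expectation_image[OF f sub] sub])
               (use Suc s in auto)
          show "AE z in measure_pmf (P s y). ?E (real j * s) z \<le> ?r ^ j * f z + real j * \<epsilon> * s"
            using Suc.IH sub[OF Suc.prems, of s] s by (auto simp: AE_measure_pmf_iff)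
        qed (use int in auto)
        also have "\<dots> = ?r ^ j * ?E s y + real j * \<epsilon> * s"
          using int by simp
        also have "\<dots> \<le> ?r ^ j * (?r * f y + \<epsilon> * s) + real j * \<epsilon> * s"
          using step[OF Suc.prems] r by (intro add_right_mono mult_left_mono) auto
        also have "\<dots> \<le> ?r ^ Suc j * f y + real (Suc j) * \<epsilon> * s"
          using mult_right_mono[OF r(2), of "\<epsilon> * s"] \<epsilon> s(1) by (simp add: algebra_simps)
        finally show ?case .
      qed
      have "1 + (- c * t) / real k = 1 - c * s" by (simp add: s_def)
      moreover have "real k * \<epsilon> * s = \<epsilon> * t" using s(4) by (simp add: mult.commute mult.left_commute)
      ultimately show ?case using iter[OF x, of k] s(4) by metis
    qed
  qed simp
  show ?thesis
  proof (rule field_le_epsilon)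
    fix e :: real assume "0 < e"
    then show "?E t x \<le> exp (- c * t) * f x + e"
      using bound[of "e / t"] t by simp
  qed
qed

section \<open>Paths of a Markov process with absorbing states\<close>

context markov_process
begin

lemma in_state_space: "0 \<le> t \<Longrightarrow> \<omega> \<in> space M \<Longrightarrow> X t \<omega> \<in> S"
  using measurable_space[OF measurable] by fastforce

lemma measurable_observable:
  "0 \<le> t \<Longrightarrow> (\<lambda>\<omega>. f (X t \<omega>)) \<in> measurable M (count_space UNIV)"
  by (rule measurable_compose[OF measurable]) auto

lemma borel_observable:
  fixes f :: "'s \<Rightarrow> real"
  shows "0 \<le> t \<Longrightarrow> (\<lambda>\<omega>. f (X t \<omega>)) \<in> borel_measurable M"
  by (rule measurable_compose[OF measurable]) auto

lemma integrable_observable: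
  fixes f :: "'s \<Rightarrow> real"
  assumes "bounded (f ` S)" "0 \<le> t"
  shows "integrable M (\<lambda>\<omega>. f (X t \<omega>))"
proof -
  obtain B where "\<And>x. x \<in> S \<Longrightarrow> \<bar>f x\<bar> \<le> B" using bounded_image_obtain[OF assms(1)] by metis
  then show ?thesis
    using assms(2) by (intro integrable_const_bound[where B = B] AE_I2 borel_observable)
      (auto intro: in_state_space)
qed

lemma subalgebra_past: "subalgebra M (past M S X s)"
proof -
  have "X r -` A \<inter> space M \<in> sets M" if "0 \<le> r" "A \<subseteq> S" for r A
    using measurable_sets[OF measurable[OF that(1)], of A] that(2) by auto
  then show ?thesis
    by (auto simp: subalgebra_def past_def space_measure_of_conv intro!: sigma_sets_le_sets_iff[THEN iffD2]
        simp: sets_measure_of_conv)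
qed

lemma sigma_finite_subalgebra_past: "sigma_finite_subalgebra M (past M S X s)"
  by (intro finite_measure_subalgebra_is_sigma_finite finite_measure_subalgebra.intro
      finite_measure_axioms finite_measure_subalgebra_axioms.intro subalgebra_past)

text \<open>
  Only events of the past that depend on the present state \<open>X s\<close> are tested here. This suffices for
  all later uses of the Markov property, which thus involve plain integrals only.
\<close>
lemma markov_integral:
  fixes f :: "'s \<Rightarrow> real"
  assumes f: "bounded (f ` S)" and "0 \<le> s" "0 \<le> t" and "A \<subseteq> S"
  shows "(\<integral>\<omega>. indicator A (X s \<omega>) * f (X (s + t) \<omega>) \<partial>M)
       = (\<integral>\<omega>. indicator A (X s \<omega>) * measure_pmf.expectation (P t (X s \<omega>)) f \<partial>M)"
proof -
  interpret F: sigma_finite_subalgebra M "past M S X s" by (rule sigma_finite_subalgebra_past)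
  let ?A = "X s -` A \<inter> space M"
  have "?A \<in> sets (past M S X s)"
    using assms by (auto simp: past_def intro!: in_measure_of)
  then have "(\<integral>\<omega>\<in>?A. f (X (s + t) \<omega>) \<partial>M)
      = (\<integral>\<omega>\<in>?A. real_cond_exp M (past M S X s) (\<lambda>\<omega>. f (X (s + t) \<omega>)) \<omega> \<partial>M)"
    using assms by (intro F.real_cond_exp_intA integrable_observable) auto
  also have "\<dots> = (\<integral>\<omega>\<in>?A. measure_pmf.expectation (P t (X s \<omega>)) f \<partial>M)"
    unfolding set_lebesgue_integral_def
  proof (intro integral_cong_AE)
    have [measurable]: "?A \<in> sets M"
      using measurable_sets[OF measurable[OF \<open>0 \<le> s\<close>], of A] \<open>A \<subseteq> S\<close> by auto
    show "(\<lambda>\<omega>. indicat_real ?A \<omega> *\<^sub>R real_cond_exp M (past M S X s) (\<lambda>\<omega>. f (X (s + t) \<omega>)) \<omega>)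
        \<in> borel_measurable M" by measurable
    show "(\<lambda>\<omega>. indicat_real ?A \<omega> *\<^sub>R measure_pmf.expectation (P t (X s \<omega>)) f)
        \<in> borel_measurable M"
      using borel_observable[OF \<open>0 \<le> s\<close>, of "\<lambda>x. measure_pmf.expectation (P t x) f"] by measurable
    show "AE \<omega> in M. indicat_real ?A \<omega> *\<^sub>R real_cond_exp M (past M S X s) (\<lambda>\<omega>. f (X (s + t) \<omega>)) \<omega>
        = indicat_real ?A \<omega> *\<^sub>R measure_pmf.expectation (P t (X s \<omega>)) f"
      using markov[OF \<open>0 \<le> s\<close> \<open>0 \<le> t\<close> f] by eventually_elim simp
  qed
  moreover have "(\<integral>\<omega>\<in>?A. u \<omega> \<partial>M) = (\<integral>\<omega>. indicator A (X s \<omega>) * u \<omega> \<partial>M)" for u :: "'a \<Rightarrow> real"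
    unfolding set_lebesgue_integral_def
    by (intro Bochner_Integration.integral_cong) (auto simp: indicator_def)
  ultimately show ?thesis by simp
qed

lemma expectation_at_time:
  fixes f :: "'s \<Rightarrow> real"
  assumes f: "bounded (f ` S)" and t: "0 \<le> t"
  shows "expectation (\<lambda>\<omega>. f (X t \<omega>)) = measure_pmf.expectation (P t x\<^sub>0) f"
proof -
  have "expectation (\<lambda>\<omega>. f (X t \<omega>)) = (\<integral>\<omega>. indicator S (X 0 \<omega>) * f (X (0 + t) \<omega>) \<partial>M)"
    by (intro Bochner_Integration.integral_cong) (auto simp: in_state_space)
  also have "\<dots> = (\<integral>\<omega>. indicator S (X 0 \<omega>) * measure_pmf.expectation (P t (X 0 \<omega>)) f \<partial>M)"
    by (rule markov_integral) (use f t in auto)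
  also have "\<dots> = (\<integral>\<omega>. measure_pmf.expectation (P t x\<^sub>0) f \<partial>M)"
  proof (intro integral_cong_AE)
    show "AE \<omega> in M. indicator S (X 0 \<omega>) * measure_pmf.expectation (P t (X 0 \<omega>)) f
        = measure_pmf.expectation (P t x\<^sub>0) f"
      using start(2) by eventually_elim (use start(1) in auto)
  qed (use borel_observable[of 0 "\<lambda>x. indicator S x * measure_pmf.expectation (P t x) f"] in auto)
  finally show ?thesis by (simp add: prob_space)
qed

text \<open>
  With \<open>f\<close> the indicator of \<open>a\<close>, the Markov property gives
  \<open>P(X s = a \<and> X (s + t) = a) = P(X s = a)\<close>.
\<close>
lemma absorbing_state_stays:
  assumes a: "a \<in> S" "P t a = return_pmf a" and "0 \<le> s" "0 \<le> t"
  shows "AE \<omega> in M. X s \<omega> = a \<longrightarrow> X (s + t) \<omega> = a"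
proof -
  let ?g = "\<lambda>\<omega>. indicat_real {a} (X s \<omega>) * indicat_real {a} (X (s + t) \<omega>)"
  have bd: "bounded (indicat_real {a} ` S)"
    by (auto simp: bounded_iff indicator_def intro!: exI[of _ 1])
  have bd': "bounded ((\<lambda>x. indicat_real {a} x * indicat_real {a} x) ` S)"
    by (auto simp: bounded_iff indicator_def intro!: exI[of _ 1])
  have int1: "integrable M (\<lambda>\<omega>. indicat_real {a} (X s \<omega>))"
    using assms by (intro integrable_observable bd)
  have int2: "integrable M ?g"
    using assms by (intro integrable_const_bound[where B = 1] AE_I2 borel_measurable_times borel_observable)
      (auto simp: indicator_def)
  have "(\<integral>\<omega>. ?g \<omega> \<partial>M) = (\<integral>\<omega>. indicator {a} (X s \<omega>)
      * measure_pmf.expectation (P t (X s \<omega>)) (indicat_real {a}) \<partial>M)"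
    by (rule markov_integral) (use assms bd in auto)
  also have "\<dots> = (\<integral>\<omega>. indicat_real {a} (X s \<omega>) \<partial>M)"
    by (intro Bochner_Integration.integral_cong) (auto simp: indicator_def a)
  finally have "(\<integral>\<omega>. indicat_real {a} (X s \<omega>) - ?g \<omega> \<partial>M) = 0"
    using int1 int2 by simp
  then have "AE \<omega> in M. indicat_real {a} (X s \<omega>) - ?g \<omega> = 0"
    using int1 int2
    by (subst (asm) integral_nonneg_eq_0_iff_AE) (auto simp: indicator_def)
  then show ?thesis
    by eventually_elim (auto simp: indicator_def split: if_splits)
qed

text \<open>
  Right-continuity in the discrete topology turns statements about all times into countably many
  statements, which is what both null sets and measurability need.
\<close>
lemma constant_from_rationals:
  assumes "\<omega> \<in> space M" "0 \<le> T" and q: "\<And>q. q \<in> \<rat> \<Longrightarrow> 0 \<le> q \<Longrightarrow> g (X (T + q) \<omega>) = k" and "T \<le> t"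
  shows "g (X t \<omega>) = k"
proof -
  have "\<forall>\<^sub>F s in at_right t. X s \<omega> = X t \<omega>"
    using assms by (intro right_continuous) auto
  then obtain b where b: "t < b" "\<And>s. t < s \<Longrightarrow> s < b \<Longrightarrow> X s \<omega> = X t \<omega>"
    by (auto simp: eventually_at_right_field)
  obtain r where r: "r \<in> \<rat>" "t - T < r" "r < b - T"
    using Rats_dense_in_real[of "t - T" "b - T"] b(1) by auto
  have "X (T + r) \<omega> = X t \<omega>" using r by (intro b(2)) auto
  moreover have "g (X (T + r) \<omega>) = k" using r \<open>T \<le> t\<close> by (intro q) auto
  ultimately show ?thesis by simp
qed

text \<open>
  Each visit to \<open>A\<close> is permanent, first along rational time increments outside one null set and then
  for all times; and since the probability of being in \<open>A\<close> at time \<open>k\<close> tends to \<open>1\<close>, almost every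
  path is in \<open>A\<close> at some integer time.
\<close>
lemma eventually_frozen:
  assumes A: "A \<subseteq> S" "\<And>a t. a \<in> A \<Longrightarrow> 0 \<le> t \<Longrightarrow> P t a = return_pmf a"
    and lim: "(\<lambda>k. prob {\<omega> \<in> space M. X (real k) \<omega> \<in> A}) \<longlonglongrightarrow> 1"
  shows "AE \<omega> in M. \<exists>k::nat. X (real k) \<omega> \<in> A \<and> (\<forall>t\<ge>real k. X t \<omega> = X (real k) \<omega>)"
proof -
  define D where "D = {\<omega> \<in> space M. \<exists>k::nat. X (real k) \<omega> \<in> A}"
  have meas: "{\<omega> \<in> space M. X (real k) \<omega> \<in> A} \<in> sets M" for k
    by (rule predE) (rule measurable_observable[where f = "\<lambda>x. x \<in> A"], simp)
  have [measurable]: "D \<in> sets M"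
    unfolding D_def by (intro sets.sets_Collect_countable_Ex meas)
  have "1 \<le> prob D"
    by (rule tendsto_upperbound[OF lim])
       (auto simp: D_def intro!: always_eventually finite_measure_mono
          sets.sets_Collect_countable_Ex meas)
  then have "prob D = 1" using prob_le_1[of D] by linarith
  then have reach: "AE \<omega> in M. \<exists>k::nat. X (real k) \<omega> \<in> A"
    using AE_prob_1[of D] by (auto simp: D_def)
  have "AE \<omega> in M. \<forall>a\<in>A. \<forall>q\<in>\<rat> \<inter> {0..}. \<forall>k::nat. X (real k) \<omega> = a \<longrightarrow> X (real k + q) \<omega> = a"
    using A countable_subset[OF A(1) countable_states]
    by (intro AE_ball_countable[THEN iffD2] AE_all_countable[THEN iffD2] ballI allI
        absorbing_state_stays) (auto intro: countable_subset[OF _ countable_rat])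
  with reach show ?thesis
    using AE_space
  proof eventually_elim
    case (elim \<omega>)
    then obtain k where k: "X (real k) \<omega> \<in> A" by blast
    have "X t \<omega> = X (real k) \<omega>" if "real k \<le> t" for t
      by (rule constant_from_rationals[where g = "\<lambda>x. x" and T = "real k"]) (use elim k that in auto)
    with k show ?case by blast
  qed
qed

text \<open>
  Measurability is genuinely at stake, because \<open>M\<close> need not be complete and \<open>measure\<close> vanishes on
  non-measurable sets. On the naturals convergence means being eventually constant, and by
  right-continuity this is a condition on the rational times after some integer time.
\<close>
lemma sets_Lim_eq:
  fixes g :: "'s \<Rightarrow> nat"
  shows "{\<omega> \<in> space M. Lim at_top (\<lambda>t. g (X t \<omega>)) = n} \<in> sets M"
proof -
  define E where "E k = {\<omega> \<in> space M. \<exists>T::nat. \<forall>q\<in>\<rat> \<inter> {0..}. g (X (real T + q) \<omega>) = k}" for k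
  have meas: "{\<omega> \<in> space M. g (X (real T + q) \<omega>) = k} \<in> sets M" if "0 \<le> q" for T q k
    by (rule predE) (rule measurable_observable[where f = "\<lambda>x. g x = k"], use that in simp)
  have [measurable]: "E k \<in> sets M" for k
    unfolding E_def
    by (intro sets.sets_Collect_countable_Ex sets.sets_Collect_countable_All' meas)
       (auto intro: countable_subset[OF _ countable_rat])
  have E_space: "E k \<subseteq> space M" for k
    by (auto simp: E_def)
  have conv: "((\<lambda>t. g (X t \<omega>)) \<longlongrightarrow> k) at_top \<longleftrightarrow> \<omega> \<in> E k" if \<omega>: "\<omega> \<in> space M" for \<omega> k
  proof
    assume "((\<lambda>t. g (X t \<omega>)) \<longlongrightarrow> k) at_top"
    then obtain b where b: "\<And>t. b \<le> t \<Longrightarrow> g (X t \<omega>) = k"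
      by (auto simp: tendsto_discrete eventually_at_top_linorder)
    obtain T :: nat where "b \<le> real T" using real_arch_simple by blast
    then have "\<forall>q\<in>\<rat> \<inter> {0..}. g (X (real T + q) \<omega>) = k"
      by (intro ballI b) auto
    with \<omega> show "\<omega> \<in> E k" unfolding E_def by blast
  next
    assume "\<omega> \<in> E k"
    then obtain T :: nat where T: "\<And>q. q \<in> \<rat> \<Longrightarrow> 0 \<le> q \<Longrightarrow> g (X (real T + q) \<omega>) = k"
      by (auto simp: E_def)
    have "g (X t \<omega>) = k" if "real T \<le> t" for t
      by (rule constant_from_rationals[where T = "real T" and g = g]) (use \<omega> T that in auto)
    then show "((\<lambda>t. g (X t \<omega>)) \<longlongrightarrow> k) at_top"
      unfolding tendsto_discrete eventually_at_top_linorder by blast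
  qed
  \<comment> \<open>Without a limit, \<open>Lim\<close> is a description over the empty predicate and hence has the same
     value \<open>d\<close> for all such paths; if \<open>d = n\<close>, all of them belong to the event.\<close>
  define d :: nat where "d = (THE l. False)"
  have "Lim at_top (\<lambda>t. g (X t \<omega>)) = n \<longleftrightarrow> \<omega> \<in> E n \<or> (d = n \<and> (\<forall>k. \<omega> \<notin> E k))"
    if \<omega>: "\<omega> \<in> space M" for \<omega>
  proof (cases "\<exists>k. \<omega> \<in> E k")
    case True
    then obtain k where k: "\<omega> \<in> E k" by blast
    have "Lim at_top (\<lambda>t. g (X t \<omega>)) = l" if "\<omega> \<in> E l" for l
      using that conv[OF \<omega>] by (intro tendsto_Lim) auto
    with k show ?thesis by blast
  next
    case False
    then show ?thesis by (simp add: t2_space_class.Lim_def conv[OF \<omega>] d_def)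
  qed
  then have "{\<omega> \<in> space M. Lim at_top (\<lambda>t. g (X t \<omega>)) = n}
      = (if d = n then E n \<union> (space M - (\<Union>k. E k)) else E n)"
    using E_space by (cases "d = n") auto
  then show ?thesis by simp
qed

end

section \<open>The generator on the segment, conservation and absorption\<close>

abbreviation segment_generator :: "nat \<Rightarrow> (config \<Rightarrow> real) \<Rightarrow> config \<Rightarrow> real" where
  "segment_generator N \<equiv> dual_generator N (segment_edges N)
     (\<lambda>y z. if \<bar>int y - int z\<bar> = 1 then 1 else 0) 1 1"

lemma dual_generator_segment:
  fixes f :: "config \<Rightarrow> real"
  shows "segment_generator N f \<xi>
    = (\<Sum>x\<in>{1..<N - 1}.
          real (\<xi> x) * (1 - real (\<xi> (Suc x))) * (f (move \<xi> x (Suc x)) - f \<xi>)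
        + real (\<xi> (Suc x)) * (1 - real (\<xi> x)) * (f (move \<xi> (Suc x) x) - f \<xi>))
      + real (\<xi> 1) * (f (move \<xi> 1 0) - f \<xi>)
      + real (\<xi> (N - 1)) * (f (move \<xi> (N - 1) N) - f \<xi>)"
proof -
  have "{(x, y). x \<in> bulk N \<and> y \<in> bulk N \<and> x < y \<and> {x, y} \<in> segment_edges N}
      = (\<lambda>x. (x, Suc x)) ` {1..<N - 1}" (is "?E = _")
  proof (intro set_eqI iffI)
    fix e assume "e \<in> ?E"
    then obtain x y where e: "e = (x, y)" "x \<in> bulk N" "y \<in> bulk N" "x < y"
      "{x, y} \<in> segment_edges N" by blast
    then obtain u v where "{x, y} = {u, v}" "\<bar>int u - int v\<bar> = 1"
      unfolding segment_edges_def by blast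
    then have "y = Suc x" using \<open>x < y\<close> by (auto simp: doubleton_eq_iff)
    with e show "e \<in> (\<lambda>x. (x, Suc x)) ` {1..<N - 1}" by (auto simp: bulk_def)
  next
    fix e assume "e \<in> (\<lambda>x. (x, Suc x)) ` {1..<N - 1}"
    then obtain x where x: "e = (x, Suc x)" "1 \<le> x" "x < N - 1" by auto
    then have "{x, Suc x} \<in> segment_edges N"
      unfolding segment_edges_def bulk_def by fastforce
    with x show "e \<in> ?E" by (auto simp: bulk_def)
  qed
  then show ?thesis
    unfolding dual_generator_def
    by (simp add: sum.reindex inj_on_def)
qed

lemma dual_configs_le_1: "\<xi> \<in> dual_configs N \<Longrightarrow> 1 \<le> x \<Longrightarrow> x < N \<Longrightarrow> \<xi> x = 0 \<or> \<xi> x = 1"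
  unfolding dual_configs_def bulk_def by (auto simp: le_Suc_eq dest!: bspec[of _ _ x])

text \<open>
  To evaluate \<open>L f\<close> at \<open>\<xi>\<close> it is enough to find, for each edge, one expression \<open>d x\<close> that equals the
  increment of \<open>f\<close> for the jump possible across the edge, in either direction, and that vanishes when
  no jump is possible. The sum over the edges then often telescopes.
\<close>
lemma segment_generator_eqI:
  fixes f :: "config \<Rightarrow> real"
  assumes "2 \<le> N" and \<xi>: "\<xi> \<in> dual_configs N"
    and right: "\<And>x. 1 \<le> x \<Longrightarrow> Suc x < N \<Longrightarrow> \<xi> x = 1 \<Longrightarrow> \<xi> (Suc x) = 0 \<Longrightarrow>
      f (move \<xi> x (Suc x)) - f \<xi> = d x"
    and left: "\<And>x. 1 \<le> x \<Longrightarrow> Suc x < N \<Longrightarrow> \<xi> x = 0 \<Longrightarrow> \<xi> (Suc x) = 1 \<Longrightarrow>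
      f (move \<xi> (Suc x) x) - f \<xi> = d x"
    and stay: "\<And>x. 1 \<le> x \<Longrightarrow> Suc x < N \<Longrightarrow> \<xi> x = \<xi> (Suc x) \<Longrightarrow> d x = 0"
    and 0: "\<xi> 1 = 1 \<Longrightarrow> f (move \<xi> 1 0) - f \<xi> = a" "\<xi> 1 = 0 \<Longrightarrow> a = 0"
    and N: "\<xi> (N - 1) = 1 \<Longrightarrow> f (move \<xi> (N - 1) N) - f \<xi> = b" "\<xi> (N - 1) = 0 \<Longrightarrow> b = 0"
  shows "segment_generator N f \<xi> = (\<Sum>x\<in>{1..<N - 1}. d x) + a + b"
proof -
  have "real (\<xi> x) * (1 - real (\<xi> (Suc x))) * (f (move \<xi> x (Suc x)) - f \<xi>)
        + real (\<xi> (Suc x)) * (1 - real (\<xi> x)) * (f (move \<xi> (Suc x) x) - f \<xi>) = d x"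
    if "x \<in> {1..<N - 1}" for x
  proof -
    have x: "1 \<le> x" "Suc x < N" using that by auto
    then show ?thesis
      using dual_configs_le_1[OF \<xi>, of x] dual_configs_le_1[OF \<xi>, of "Suc x"]
        right[OF x] left[OF x] stay[OF x] by fastforce
  qed
  moreover have "real (\<xi> 1) * (f (move \<xi> 1 0) - f \<xi>) = a"
    using dual_configs_le_1[OF \<xi>, of 1] 0 \<open>2 \<le> N\<close> by auto
  moreover have "real (\<xi> (N - 1)) * (f (move \<xi> (N - 1) N) - f \<xi>) = b"
    using dual_configs_le_1[OF \<xi>, of "N - 1"] N \<open>2 \<le> N\<close>
    by (cases "\<xi> (N - 1) = 0") auto
  ultimately show ?thesis
    unfolding dual_generator_segment by simp
qed

definition particle_number :: "nat \<Rightarrow> config \<Rightarrow> nat" where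
  "particle_number N \<xi> = (\<Sum>x\<le>N. \<xi> x)"

lemma particle_number_move:
  assumes "x \<le> N" "y \<le> N" "x \<noteq> y" "1 \<le> \<xi> x"
  shows "particle_number N (move \<xi> x y) = particle_number N \<xi>"
proof -
  have 1: "{..N} = insert x (insert y ({..N} - {x, y}))" using assms by auto
  have "(\<Sum>z\<in>{..N} - {x, y}. move \<xi> x y z) = (\<Sum>z\<in>{..N} - {x, y}. \<xi> z)"
    by (rule sum.cong) (auto simp: move_def)
  then show ?thesis
    unfolding particle_number_def by (subst (1 2) 1) (use assms in \<open>simp add: move_def\<close>)
qed

lemma generator_particle_number:
  fixes g :: "nat \<Rightarrow> real"
  assumes "2 \<le> N" "\<xi> \<in> dual_configs N"
  shows "segment_generator N (\<lambda>\<xi>. g (particle_number N \<xi>)) \<xi> = 0"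
  using segment_generator_eqI[OF assms, where d = "\<lambda>_. 0" and a = 0 and b = 0] assms
  by (simp add: particle_number_move)

text \<open>
  The potential of a single particle at \<open>x\<close> is \<open>x * (N - x)\<close>: it vanishes at both absorbing sites and
  has discrete Laplacian \<open>-2\<close>.
\<close>
definition potential :: "nat \<Rightarrow> config \<Rightarrow> real" where
  "potential N \<xi> = (\<Sum>x\<le>N. real (\<xi> x) * (real x * (real N - real x)))"

lemma potential_move:
  assumes "x \<le> N" "y \<le> N" "x \<noteq> y" "1 \<le> \<xi> x"
  shows "potential N (move \<xi> x y) - potential N \<xi>
    = real y * (real N - real y) - real x * (real N - real x)"
proof -
  have 1: "{..N} = insert x (insert y ({..N} - {x, y}))" using assms by auto
  have "(\<Sum>z\<in>{..N} - {x, y}. real (move \<xi> x y z) * (real z * (real N - real z)))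
      = (\<Sum>z\<in>{..N} - {x, y}. real (\<xi> z) * (real z * (real N - real z)))"
    by (rule sum.cong) (auto simp: move_def)
  then show ?thesis
    unfolding potential_def
    by (subst (1 2) 1) (use assms in \<open>simp add: move_def algebra_simps of_nat_diff\<close>)
qed

text \<open>
  For symmetric exclusion the increment of a sum of single-particle functions across an edge is
  linear in \<open>\<xi>\<close>: when both ends are occupied, the two increments that exclusion suppresses would have
  cancelled. So \<open>L\<close> acts as the discrete Laplacian of the single-particle potential, which appears
  after a summation by parts.
\<close>
lemma generator_potential:
  assumes "2 \<le> N" "\<xi> \<in> dual_configs N"
  shows "segment_generator N (potential N) \<xi>
    = - 2 * (\<Sum>x\<in>{1..N - 1}. real (\<xi> x))"
proof -
  let ?d = "\<lambda>x. (real (\<xi> x) - real (\<xi> (Suc x))) * (real N - 2 * real x - 1)"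
  have "segment_generator N (potential N) \<xi>
    = (\<Sum>x\<in>{1..<N - 1}. ?d x) + - real (\<xi> 1) * (real N - 1)
      + - real (\<xi> (N - 1)) * (real N - 1)"
    by (rule segment_generator_eqI[OF assms])
       (use assms(1) in \<open>auto simp: potential_move of_nat_diff algebra_simps\<close>)
  \<comment> \<open>The partial summation, in a form that can be proved by induction on the upper end.\<close>
  moreover have "(\<Sum>x\<in>{1..<m}. ?d x)
      = (real N - 1) * real (\<xi> 1) - (real N - 2 * real m - 1) * real (\<xi> m)
        - 2 * (\<Sum>x\<in>{1..m}. real (\<xi> x))" if "1 \<le> m" for m
    using that by (induction m rule: nat_induct_at_least) (simp_all add: algebra_simps)
  from this[of "N - 1"] have "(\<Sum>x\<in>{1..<N - 1}. ?d x)
      = (real N - 1) * real (\<xi> 1) + (real N - 1) * real (\<xi> (N - 1))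
        - 2 * (\<Sum>x\<in>{1..N - 1}. real (\<xi> x))"
    using assms(1) by (simp add: of_nat_diff algebra_simps)
  ultimately show ?thesis by simp
qed

lemma potential_eq_bulk_sum:
  assumes "1 \<le> N"
  shows "potential N \<xi> = (\<Sum>x\<in>{1..N - 1}. real (\<xi> x) * (real x * (real N - real x)))"
  unfolding potential_def
  by (rule sum.mono_neutral_right) (use assms in \<open>auto simp: not_le Suc_le_eq\<close>)

text \<open>
  Together with \<open>generator_potential\<close> this yields \<open>L V \<le> - (2 / N\<^sup>2) * V\<close> for the potential \<open>V\<close>.
\<close>
lemma potential_le:
  assumes "1 \<le> N"
  shows "potential N \<xi> \<le> (real N)\<^sup>2 * (\<Sum>x\<in>{1..N - 1}. real (\<xi> x))"
  unfolding potential_eq_bulk_sum[OF assms] sum_distrib_left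
proof (rule sum_mono)
  fix x assume "x \<in> {1..N - 1}"
  then have "real x * (real N - real x) \<le> (real N)\<^sup>2"
    unfolding power2_eq_square by (intro mult_mono) auto
  then show "real (\<xi> x) * (real x * (real N - real x)) \<le> (real N)\<^sup>2 * real (\<xi> x)"
    by (subst mult.commute) (rule mult_right_mono, auto)
qed

lemma potential_nonneg: "0 \<le> potential N \<xi>"
  unfolding potential_def by (intro sum_nonneg) auto

lemma potential_ge_1:
  assumes "1 \<le> x" "x < N" "\<xi> x \<noteq> 0"
  shows "1 \<le> potential N \<xi>"
proof -
  have "1 * (1 * 1) \<le> real (\<xi> x) * (real x * (real N - real x))"
    using assms by (intro mult_mono) auto
  also have "\<dots> \<le> potential N \<xi>"
    unfolding potential_def using assms by (intro member_le_sum) auto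
  finally show ?thesis by simp
qed

text \<open>
  The positive maximum principle. The rates \<open>\<xi> x * (1 - \<xi> y)\<close> are nonnegative because bulk sites of
  the configurations considered carry at most one particle.
\<close>
lemma generator_nonpos_at_max:
  fixes f :: "config \<Rightarrow> real"
  assumes "2 \<le> N" "\<xi> \<in> dual_configs N" and f: "\<And>\<eta>. f \<eta> \<le> f \<xi>"
  shows "segment_generator N f \<xi> \<le> 0"
proof -
  have "real (\<xi> x) * (1 - real (\<xi> y)) * (f (move \<xi> x y) - f \<xi>) \<le> 0" if "1 \<le> y" "y < N" for x y
    using dual_configs_le_1[OF assms(2) that] f[of "move \<xi> x y"] by (auto intro!: mult_nonneg_nonpos)
  moreover have "real (\<xi> x) * (f (move \<xi> x y) - f \<xi>) \<le> 0" for x y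
    using f[of "move \<xi> x y"] by (auto intro!: mult_nonneg_nonpos)
  ultimately show ?thesis
    unfolding dual_generator_segment by (intro add_nonpos_nonpos sum_nonpos) auto
qed

definition absorbed :: "nat \<Rightarrow> config set" where
  "absorbed N = {\<xi> \<in> dual_configs N. \<forall>x\<in>bulk N. \<xi> x = 0}"

lemma generator_absorbed:
  assumes "\<xi> \<in> absorbed N" "2 \<le> N"
  shows "segment_generator N f \<xi> = 0"
  unfolding dual_generator_segment
  using assms by (simp add: absorbed_def bulk_def)

section \<open>The harmonic function\<close>

definition left_count :: "config \<Rightarrow> nat \<Rightarrow> nat" where
  "left_count \<xi> x = (\<Sum>y\<in>{1..<x}. \<xi> y)"

text \<open>
  The \<open>i\<close>-th bulk particle from the left has \<open>left_count\<close> equal to \<open>i - 1\<close>, so this is the product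
  \<open>\<Prod>i. (x\<^sub>i - (i - 1)) / (N - (i - 1))\<close> over the particles still in the bulk. Particles already
  absorbed at \<open>N\<close> contribute \<open>1\<close>, and a particle absorbed at \<open>0\<close> makes the value \<open>0\<close>.
\<close>
definition all_right :: "nat \<Rightarrow> config \<Rightarrow> real" where
  "all_right N \<xi> = (if \<xi> 0 = 0 then \<Prod>x\<in>{1..<N}. if \<xi> x = 0 then 1
     else (real x - real (left_count \<xi> x)) / (real N - real (left_count \<xi> x)) else 0)"

lemma left_count_less:
  assumes "\<xi> \<in> dual_configs N" "1 \<le> x" "x \<le> N"
  shows "left_count \<xi> x < x"
proof -
  have "left_count \<xi> x \<le> (\<Sum>y\<in>{1..<x}. 1)"
    unfolding left_count_def
    by (rule sum_mono) (use dual_configs_le_1[OF assms(1)] assms in fastforce)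
  then show ?thesis using assms by simp
qed

lemma all_right_range:
  assumes "\<xi> \<in> dual_configs N"
  shows "0 \<le> all_right N \<xi>" "all_right N \<xi> \<le> 1"
proof -
  have "0 \<le> (real x - real (left_count \<xi> x)) / (real N - real (left_count \<xi> x))
      \<and> (real x - real (left_count \<xi> x)) / (real N - real (left_count \<xi> x)) \<le> 1"
    if "x \<in> {1..<N}" for x
    using left_count_less[OF assms, of x] that by (auto simp: divide_le_eq_1)
  then show "0 \<le> all_right N \<xi>" "all_right N \<xi> \<le> 1"
    unfolding all_right_def by (auto intro!: prod_nonneg prod_le_1)
qed

lemma left_count_Suc: "1 \<le> x \<Longrightarrow> left_count \<xi> (Suc x) = left_count \<xi> x + \<xi> x"
  by (simp add: left_count_def)

text \<open>
  A jump to the right raises only the numerator belonging to the jumping particle, from \<open>x - c\<close> to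
  \<open>x + 1 - c\<close>: the particle keeps its rank, hence its denominator \<open>N - c\<close>, and the other particles
  keep their ranks as well. Reading the lemma from \<open>\<eta>\<close> to \<open>\<xi>\<close> covers the jump to the left.
\<close>
lemma all_right_jump:
  assumes x: "1 \<le> x" "Suc x < N"
    and jump: "\<xi> x = 1" "\<xi> (Suc x) = 0" "\<eta> x = 0" "\<eta> (Suc x) = 1"
    and off: "\<And>z. z \<noteq> x \<Longrightarrow> z \<noteq> Suc x \<Longrightarrow> \<eta> z = \<xi> z"
  shows "(real x - real (left_count \<xi> x)) * all_right N \<eta>
       = (real x + 1 - real (left_count \<xi> x)) * all_right N \<xi>"
    and "left_count \<eta> x = left_count \<xi> x"
proof -
  have below: "left_count \<eta> z = left_count \<xi> z" if "z \<le> x" for z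
    unfolding left_count_def by (rule sum.cong) (use that off in auto)
  then show "left_count \<eta> x = left_count \<xi> x" by simp
  have above: "left_count \<eta> z = left_count \<xi> z" if "Suc (Suc x) \<le> z" for z
    using that
  proof (induction z rule: nat_induct_at_least)
    case base
    show ?case using x jump below[of x] by (simp add: left_count_Suc)
  next
    case (Suc z)
    then show ?case using off[of z] by (simp add: left_count_Suc)
  qed
  have split: "{1..<N} = insert x (insert (Suc x) ({1..<N} - {x, Suc x}))" using x by auto
  let ?F = "\<lambda>\<xi> z. if \<xi> z = 0 then 1
     else (real z - real (left_count \<xi> z)) / (real N - real (left_count \<xi> z))"
  let ?c = "real (left_count \<xi> x)"
  define R where "R = (\<Prod>z\<in>{1..<N} - {x, Suc x}. ?F \<xi> z)"
  have "(\<Prod>z\<in>{1..<N} - {x, Suc x}. ?F \<eta> z) = R"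
    unfolding R_def
  proof (rule prod.cong)
    fix z assume z: "z \<in> {1..<N} - {x, Suc x}"
    then consider "z < x" | "Suc (Suc x) \<le> z" by force
    then show "?F \<eta> z = ?F \<xi> z" using off[of z] below[of z] above[of z] z by cases auto
  qed simp
  moreover have "left_count \<eta> (Suc x) = left_count \<xi> x"
    using x jump below[of x] by (simp add: left_count_Suc)
  ultimately have "all_right N \<eta> = (if \<xi> 0 = 0 then (real x + 1 - ?c) / (real N - ?c) * R else 0)"
    unfolding all_right_def by (subst split) (use x jump off[of 0] in \<open>simp add: algebra_simps\<close>)
  moreover have "all_right N \<xi> = (if \<xi> 0 = 0 then (real x - ?c) / (real N - ?c) * R else 0)"
    unfolding all_right_def R_def by (subst split) (use x jump in simp)
  ultimately show "(real x - ?c) * all_right N \<eta> = (real x + 1 - ?c) * all_right N \<xi>"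
    by simp
qed

text \<open>
  The last particle leaves the product together with its factor \<open>(N - 1 - c) / (N - c)\<close>. This is the
  same effect as raising that factor to \<open>(N - c) / (N - c)\<close>, so absorption at \<open>N\<close> is consistent with
  a jump inside the bulk.
\<close>
lemma all_right_exit:
  assumes N: "2 \<le> N" and \<xi>: "\<xi> \<in> dual_configs N" "\<xi> (N - 1) = 1"
  shows "all_right N (move \<xi> (N - 1) N) - all_right N \<xi>
       = all_right N \<xi> / (real (N - 1) - real (left_count \<xi> (N - 1)))"
proof -
  let ?\<eta> = "move \<xi> (N - 1) N" and ?c = "left_count \<xi> (N - 1)"
  let ?F = "\<lambda>\<xi> z. if \<xi> z = 0 then 1
     else (real z - real (left_count \<xi> z)) / (real N - real (left_count \<xi> z))"
  have lc: "left_count ?\<eta> z = left_count \<xi> z" if "z < N" for z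
    unfolding left_count_def by (rule sum.cong) (use that in \<open>auto simp: move_def\<close>)
  have split: "{1..<N} = insert (N - 1) {1..<N - 1}" using N by auto
  have "(\<Prod>z\<in>{1..<N - 1}. ?F ?\<eta> z) = (\<Prod>z\<in>{1..<N - 1}. ?F \<xi> z)"
  proof (rule prod.cong)
    fix z assume "z \<in> {1..<N - 1}"
    then have z: "z < N - 1" by simp
    then have "?\<eta> z = \<xi> z" by (simp add: move_def)
    moreover have "left_count ?\<eta> z = left_count \<xi> z" by (rule lc) (use z in simp)
    ultimately show "?F ?\<eta> z = ?F \<xi> z" by simp
  qed simp
  moreover have "?\<eta> 0 = \<xi> 0" "?\<eta> (N - 1) = 0" using N \<xi> by (auto simp: move_def)
  ultimately have "all_right N \<xi> = all_right N ?\<eta> * ((real (N - 1) - ?c) / (real N - ?c))"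
    unfolding all_right_def by (subst (1 2) split) (use \<xi> in simp)
  moreover have "?c < N - 1" using left_count_less[OF \<xi>(1), of "N - 1"] N by simp
  then have "real ?c < real N - 1" using N by (simp add: of_nat_diff)
  ultimately show ?thesis using N by (simp add: of_nat_diff field_simps)
qed

text \<open>
  Put \<open>w x = h * \<xi> x / (x - c x)\<close>, where \<open>h\<close> is the value at \<open>\<xi>\<close> and \<open>c x\<close> the number of particles to
  the left of \<open>x\<close>. The increment of \<open>h\<close> across the edge between \<open>x\<close> and \<open>x + 1\<close> is always
  \<open>w x - w (x + 1)\<close>; in particular it vanishes when both ends are occupied, since then
  \<open>c (x + 1) = c x + 1\<close>. This is the point where the shifts by \<open>i - 1\<close> are needed. The sum
  telescopes to \<open>w 1 - w (N - 1)\<close>, which the two boundary terms \<open>- w 1\<close> and \<open>w (N - 1)\<close> cancel.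
\<close>
lemma generator_all_right:
  assumes N: "2 \<le> N" and \<xi>: "\<xi> \<in> dual_configs N"
  shows "segment_generator N (all_right N) \<xi> = 0"
proof -
  define w where "w x = all_right N \<xi> * real (\<xi> x) / (real x - real (left_count \<xi> x))" for x
  have pos: "real (left_count \<xi> x) < real x" if "1 \<le> x" "x < N" for x
    using left_count_less[OF \<xi> that(1)] that by simp
  have "segment_generator N (all_right N) \<xi>
    = (\<Sum>x\<in>{1..<N - 1}. w x - w (Suc x)) + - w 1 + w (N - 1)"
  proof (rule segment_generator_eqI[OF N \<xi>])
    fix x assume x: "1 \<le> x" "Suc x < N"
    note lc = left_count_Suc[OF x(1), of \<xi>]
    {
      assume v: "\<xi> x = 1" "\<xi> (Suc x) = 0"
      have "(real x - real (left_count \<xi> x)) * all_right N (move \<xi> x (Suc x))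
          = (real x + 1 - real (left_count \<xi> x)) * all_right N \<xi>"
        by (rule all_right_jump(1)) (use x v in \<open>auto simp: move_def\<close>)
      then show "all_right N (move \<xi> x (Suc x)) - all_right N \<xi> = w x - w (Suc x)"
        using pos[of x] x v by (simp add: w_def field_simps)
    next
      assume v: "\<xi> x = 0" "\<xi> (Suc x) = 1"
      note j = all_right_jump[of x N "move \<xi> (Suc x) x" \<xi>]
      have "left_count \<xi> x = left_count (move \<xi> (Suc x) x) x"
        by (rule j(2)) (use x v in \<open>auto simp: move_def\<close>)
      moreover have "(real x - real (left_count (move \<xi> (Suc x) x) x)) * all_right N \<xi>
          = (real x + 1 - real (left_count (move \<xi> (Suc x) x) x)) * all_right N (move \<xi> (Suc x) x)"
        by (rule j(1)) (use x v in \<open>auto simp: move_def\<close>)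
      ultimately show "all_right N (move \<xi> (Suc x) x) - all_right N \<xi> = w x - w (Suc x)"
        using pos[of x] x v lc by (simp add: w_def field_simps)
    next
      assume "\<xi> x = \<xi> (Suc x)"
      then show "w x - w (Suc x) = 0"
        using lc dual_configs_le_1[OF \<xi>, of x] x by (auto simp: w_def)
    }
  next
    assume "\<xi> 1 = 1"
    then show "all_right N (move \<xi> 1 0) - all_right N \<xi> = - w 1"
      by (simp add: w_def left_count_def all_right_def move_def)
  next
    assume "\<xi> (N - 1) = 1"
    then show "all_right N (move \<xi> (N - 1) N) - all_right N \<xi> = w (N - 1)"
      using all_right_exit[OF N \<xi>] by (simp add: w_def)
  qed (auto simp: w_def)
  moreover have "(\<Sum>x\<in>{1..<N - 1}. w x - w (Suc x)) = w 1 - w (N - 1)"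
    using sum_Suc_diff'[of 1 "N - 1" "\<lambda>x. - w x"] N by simp
  ultimately show ?thesis by simp
qed

lemma all_right_indicator:
  assumes x: "\<forall>i\<in>{1..n}. 1 \<le> x i \<and> x i \<le> N - 1" and mono: "strict_mono_on {1..n} x"
  shows "all_right N (indicator_config (x ` {1..n}))
       = (\<Prod>i=1..n. (real (x i) - (real i - 1)) / (real N - (real i - 1)))"
proof -
  let ?J = "x ` {1..n}" and ?\<xi> = "indicator_config (x ` {1..n})"
  have inj: "inj_on x {1..n}" using mono by (rule strict_mono_on_imp_inj_on)
  have less: "x i < x j \<longleftrightarrow> i < j" if "i \<in> {1..n}" "j \<in> {1..n}" for i j
    using mono that by (simp add: strict_mono_on_less)
  have J: "?J \<subseteq> {1..<N}" using x by force
  have count: "left_count ?\<xi> (x i) = i - 1" if i: "i \<in> {1..n}" for i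
  proof -
    have "left_count ?\<xi> (x i) = card ({1..<x i} \<inter> ?J)"
      unfolding left_count_def indicator_config_def by (simp add: sum.If_cases)
    also have "{1..<x i} \<inter> ?J = x ` {1..<i}" using i x less by force
    also have "card \<dots> = i - 1"
      using card_image[OF inj_on_subset[OF inj, of "{1..<i}"]] i by fastforce
    finally show ?thesis .
  qed
  have "all_right N ?\<xi> = (\<Prod>z\<in>{1..<N}. if z \<in> ?J
      then (real z - real (left_count ?\<xi> z)) / (real N - real (left_count ?\<xi> z)) else 1)"
    using J unfolding all_right_def by (auto simp: indicator_config_def intro!: prod.cong)
  also have "\<dots> = (\<Prod>z\<in>?J. (real z - real (left_count ?\<xi> z)) / (real N - real (left_count ?\<xi> z)))"
    using J by (simp add: prod.If_cases Int_absorb1)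
  also have "\<dots> = (\<Prod>i\<in>{1..n}. (real (x i) - real (i - 1)) / (real N - real (i - 1)))"
    unfolding prod.reindex[OF inj] by (intro prod.cong refl) (simp only: o_def count)
  also have "\<dots> = (\<Prod>i=1..n. (real (x i) - (real i - 1)) / (real N - (real i - 1)))"
    by (rule prod.cong) (auto simp: of_nat_diff)
  finally show ?thesis .
qed

section \<open>The probability of full absorption on the right\<close>

locale dual_segment = markov_process M "dual_configs N" P \<xi> "indicator_config J"
  for N :: nat and M :: "'a measure" and P and \<xi> and J +
  assumes N: "2 \<le> N"
    and generator: "has_generator (dual_configs N) P
      (segment_generator N)"
    and J: "J \<subseteq> bulk N"
begin

lemma supermartingale:
  assumes f: "bounded (f ` dual_configs N)" and "0 \<le> c" "0 \<le> t"
    and "\<And>\<eta>. \<eta> \<in> dual_configs N \<Longrightarrow> segment_generator N f \<eta> \<le> - c * f \<eta>"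
  shows "expectation (\<lambda>\<omega>. f (\<xi> t \<omega>)) \<le> exp (- c * t) * f (indicator_config J)"
  using expectation_decay[OF semigroup generator f \<open>0 \<le> c\<close> _ \<open>0 \<le> t\<close> start(1)] assms
  by (simp add: expectation_at_time)

lemma martingale:
  assumes f: "bounded (f ` dual_configs N)" and "0 \<le> t"
    and Lf: "\<And>\<eta>. \<eta> \<in> dual_configs N \<Longrightarrow> segment_generator N f \<eta> = 0"
  shows "expectation (\<lambda>\<omega>. f (\<xi> t \<omega>)) = f (indicator_config J)"
proof (rule antisym)
  show "expectation (\<lambda>\<omega>. f (\<xi> t \<omega>)) \<le> f (indicator_config J)"
    using supermartingale[OF f, of 0 t] assms by simp
  have "segment_generator N (\<lambda>\<eta>. - f \<eta>) \<eta>
    = - segment_generator N f \<eta>" for \<eta>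
  proof -
    have "k * (- u - - v) = - (k * (u - v))" for k u v :: real
      by (simp add: algebra_simps)
    then show ?thesis
      unfolding dual_generator_segment by (simp only: minus_add_distrib sum_negf[symmetric])
  qed
  then show "f (indicator_config J) \<le> expectation (\<lambda>\<omega>. f (\<xi> t \<omega>))"
    using supermartingale[of "\<lambda>\<eta>. - f \<eta>" 0 t] assms by (simp add: image_image[symmetric])
qed

lemma particle_number_conserved:
  assumes "0 \<le> t"
  shows "AE \<omega> in M. particle_number N (\<xi> t \<omega>) = card J"
proof -
  let ?f = "\<lambda>\<eta>. of_bool (particle_number N \<eta> \<noteq> card J) :: real"
  have bd: "bounded (?f ` dual_configs N)" by (auto simp: bounded_iff intro!: exI[of _ 1])
  have "J \<subseteq> {..N}" using J by (force simp: bulk_def)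
  then have "particle_number N (indicator_config J) = card J"
    by (simp add: particle_number_def indicator_config_def sum.If_cases Int_absorb1)
  moreover have "expectation (\<lambda>\<omega>. ?f (\<xi> t \<omega>)) = ?f (indicator_config J)"
    by (rule martingale[OF bd assms]) (rule generator_particle_number[OF N])
  ultimately have "expectation (\<lambda>\<omega>. ?f (\<xi> t \<omega>)) = 0" by simp
  then have "AE \<omega> in M. ?f (\<xi> t \<omega>) = 0"
    using integrable_observable[OF bd assms] by (subst (asm) integral_nonneg_eq_0_iff_AE) auto
  then show ?thesis by eventually_elim (simp split: if_splits)
qed

text \<open>
  A generator that vanishes at \<open>a\<close> keeps the process at \<open>a\<close>: for \<open>f\<close> the negative indicator of \<open>a\<close> the
  inequality \<open>L f \<le> 0\<close> holds everywhere, at \<open>a\<close> because nothing can jump there and elsewhere because \<open>f\<close> is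
  maximal. Hence \<open>P t f a \<le> - 1\<close>.
\<close>
lemma absorbed_absorbing:
  assumes a: "a \<in> absorbed N" and t: "0 \<le> t"
  shows "P t a = return_pmf a"
proof -
  let ?f = "\<lambda>\<eta>. - indicat_real {a} \<eta>"
  have a': "a \<in> dual_configs N" using a by (simp add: absorbed_def)
  have "measure_pmf.expectation (P t a) ?f \<le> exp (- 0 * t) * ?f a"
  proof (rule expectation_decay[OF semigroup generator _ _ _ t a'])
    show "bounded (?f ` dual_configs N)"
      by (auto simp: bounded_iff indicator_def intro!: exI[of _ 1])
    fix \<eta> assume \<eta>: "\<eta> \<in> dual_configs N"
    show "segment_generator N ?f \<eta> \<le> - 0 * ?f \<eta>"
    proof (cases "\<eta> = a")
      case True
      then show ?thesis using generator_absorbed[OF a N] by simp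
    next
      case False
      then show ?thesis
        using generator_nonpos_at_max[OF N \<eta>, of ?f] by (simp add: indicator_def)
    qed
  qed simp
  then have "1 \<le> measure_pmf.prob (P t a) {a}" by simp
  then have "measure_pmf.prob (P t a) {a} = 1"
    using measure_pmf.prob_le_1[of "P t a" "{a}"] by linarith
  then have "set_pmf (P t a) \<subseteq> {a}"
    using measure_pmf.AE_prob_1[of "P t a" "{a}"] by (auto simp: AE_measure_pmf_iff)
  then show ?thesis by (simp add: set_pmf_subset_singleton)
qed

text \<open>
  The expected potential decays exponentially, and the potential is at least \<open>1\<close> as long as a
  particle is left in the bulk; so the bulk is empty at time \<open>t\<close> with probability tending to \<open>1\<close>.
\<close>
lemma prob_absorbed: "(\<lambda>k. prob {\<omega> \<in> space M. \<xi> (real k) \<omega> \<in> absorbed N}) \<longlonglongrightarrow> 1"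
proof (rule tendsto_sandwich)
  let ?V = "potential N" let ?c = "2 / (real N)\<^sup>2"
  have V_le: "?V \<eta> \<le> (real N)\<^sup>2 * real N" if "\<eta> \<in> dual_configs N" for \<eta>
  proof -
    have "(\<Sum>x\<in>{1..N - 1}. real (\<eta> x)) \<le> (\<Sum>x\<in>{1..N - 1}. 1)"
      by (rule sum_mono) (use dual_configs_le_1[OF that] in fastforce)
    also have "\<dots> \<le> real N" by simp
    finally have "(real N)\<^sup>2 * (\<Sum>x\<in>{1..N - 1}. real (\<eta> x)) \<le> (real N)\<^sup>2 * real N"
      by (rule mult_left_mono) simp
    then show ?thesis using potential_le[of N \<eta>] N by linarith
  qed
  have bd: "bounded (?V ` dual_configs N)"
    using V_le potential_nonneg by (auto simp: bounded_iff)
  have EV: "expectation (\<lambda>\<omega>. ?V (\<xi> t \<omega>)) \<le> exp (- ?c * t) * ?V (indicator_config J)"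
    if "0 \<le> t" for t
  proof (rule supermartingale[OF bd _ that])
    fix \<eta> assume \<eta>: "\<eta> \<in> dual_configs N"
    have "?c * ?V \<eta> \<le> 2 * (\<Sum>x\<in>{1..N - 1}. real (\<eta> x))"
      using potential_le[of N \<eta>] N by (simp add: pos_divide_le_eq mult.commute)
    then show "segment_generator N ?V \<eta> \<le> - ?c * ?V \<eta>"
      using generator_potential[OF N \<eta>] by simp
  qed simp
  have low: "1 - exp (- ?c * real k) * ?V (indicator_config J)
      \<le> prob {\<omega> \<in> space M. \<xi> (real k) \<omega> \<in> absorbed N}" for k
  proof -
    let ?A = "{\<omega> \<in> space M. \<xi> (real k) \<omega> \<in> absorbed N}"
    have A: "?A \<in> sets M"
      by (rule predE) (rule measurable_observable[where f = "\<lambda>x. x \<in> absorbed N"], simp)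
    have "1 - ?V (\<xi> (real k) \<omega>) \<le> indicator ?A \<omega>" if \<omega>: "\<omega> \<in> space M" for \<omega>
    proof (cases "\<xi> (real k) \<omega> \<in> absorbed N")
      case True
      then show ?thesis using that potential_nonneg[of N "\<xi> (real k) \<omega>"] by simp
    next
      case False
      then obtain x where "x \<in> bulk N" "\<xi> (real k) \<omega> x \<noteq> 0"
        using in_state_space[OF _ \<omega>, of "real k"] by (auto simp: absorbed_def)
      then have "1 \<le> ?V (\<xi> (real k) \<omega>)"
        by (intro potential_ge_1[of x]) (auto simp: bulk_def)
      then show ?thesis by (simp add: indicator_def)
    qed
    moreover have V_int: "integrable M (\<lambda>\<omega>. ?V (\<xi> (real k) \<omega>))"
      by (rule integrable_observable[OF bd]) simp
    moreover have "integrable M (indicat_real ?A)"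
      using A by (simp add: integrable_indicator_iff less_top[symmetric])
    ultimately have "expectation (\<lambda>\<omega>. 1 - ?V (\<xi> (real k) \<omega>)) \<le> expectation (indicat_real ?A)"
      by (intro integral_mono) simp_all
    also have "expectation (\<lambda>\<omega>. 1 - ?V (\<xi> (real k) \<omega>)) = 1 - expectation (\<lambda>\<omega>. ?V (\<xi> (real k) \<omega>))"
      using V_int by (simp add: prob_space)
    finally show ?thesis using EV[of "real k"] A by simp
  qed
  then show "\<forall>\<^sub>F k in sequentially. 1 - exp (- ?c * real k) * ?V (indicator_config J)
      \<le> prob {\<omega> \<in> space M. \<xi> (real k) \<omega> \<in> absorbed N}" by simp
  have "(\<lambda>k. exp (- c * real k)) \<longlonglongrightarrow> 0" if "0 < c" for c
    using that by real_asymp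
  from this[of ?c] have "(\<lambda>k. exp (- ?c * real k)) \<longlonglongrightarrow> 0" using N by force
  then have "(\<lambda>k. 1 - exp (- ?c * real k) * ?V (indicator_config J))
      \<longlonglongrightarrow> 1 - 0 * ?V (indicator_config J)"
    by (intro tendsto_intros)
  then show "(\<lambda>k. 1 - exp (- ?c * real k) * ?V (indicator_config J)) \<longlonglongrightarrow> 1" by simp
qed auto

text \<open>
  Once the bulk is empty, \<open>n\<close> particles at \<open>N\<close> means the same as none at \<open>0\<close>.
\<close>
lemma all_right_absorbed:
  assumes "\<eta> \<in> absorbed N" "particle_number N \<eta> = n"
  shows "all_right N \<eta> = of_bool (\<eta> N = n)"
proof -
  have z: "\<eta> x = 0" if "x \<in> {1..<N}" for x
    using assms(1) that by (auto simp: absorbed_def bulk_def)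
  have "{..N} = insert 0 (insert N {1..<N})" using N by auto
  then have "particle_number N \<eta> = \<eta> 0 + \<eta> N"
    unfolding particle_number_def using z N by simp
  then have "\<eta> N = n \<longleftrightarrow> \<eta> 0 = 0" using assms(2) by auto
  moreover have "all_right N \<eta> = of_bool (\<eta> 0 = 0)"
    unfolding all_right_def using z by simp
  ultimately show ?thesis by simp
qed

text \<open>
  The expectation of \<open>all_right\<close> does not change in time. As time goes to infinity the process
  freezes in an absorbed configuration, where \<open>all_right\<close> is the indicator of the event; dominated
  convergence identifies the limit.
\<close>
lemma prob_all_right:
  "prob {\<omega> \<in> space M. final_config \<xi> \<omega> N = card J} = all_right N (indicator_config J)"
proof -
  let ?F = "{\<omega> \<in> space M. final_config \<xi> \<omega> N = card J}"
  have F: "?F \<in> sets M"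
    unfolding final_config_def by (rule sets_Lim_eq[where g = "\<lambda>\<eta>. \<eta> N"])
  have range: "0 \<le> all_right N (\<xi> (real k) \<omega>)" "all_right N (\<xi> (real k) \<omega>) \<le> 1"
    if "\<omega> \<in> space M" for k \<omega>
    using all_right_range in_state_space[OF _ that, of "real k"] by auto
  have bd: "bounded (all_right N ` dual_configs N)"
    using all_right_range by (auto simp: bounded_iff intro!: exI[of _ 1])
  have frozen: "AE \<omega> in M. \<exists>k::nat. \<xi> (real k) \<omega> \<in> absorbed N \<and> (\<forall>t\<ge>real k. \<xi> t \<omega> = \<xi> (real k) \<omega>)"
    by (rule eventually_frozen[OF _ absorbed_absorbing prob_absorbed]) (auto simp: absorbed_def)
  have "AE \<omega> in M. \<forall>k::nat. particle_number N (\<xi> (real k) \<omega>) = card J"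
    by (intro AE_all_countable[THEN iffD2] allI particle_number_conserved) simp
  with frozen have lim: "AE \<omega> in M. (\<lambda>k. all_right N (\<xi> (real k) \<omega>)) \<longlonglongrightarrow> indicator ?F \<omega>"
    using AE_space
  proof eventually_elim
    case (elim \<omega>)
    from elim(1) obtain k where k: "\<xi> (real k) \<omega> \<in> absorbed N"
      "\<And>t. real k \<le> t \<Longrightarrow> \<xi> t \<omega> = \<xi> (real k) \<omega>" by blast
    have "((\<lambda>t. \<xi> t \<omega> N) \<longlongrightarrow> \<xi> (real k) \<omega> N) at_top"
    proof (rule tendsto_eventually)
      show "\<forall>\<^sub>F t in at_top. \<xi> t \<omega> N = \<xi> (real k) \<omega> N"
        using eventually_ge_at_top[of "real k"] by eventually_elim (drule k(2), simp only:)
    qed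
    then have "final_config \<xi> \<omega> N = \<xi> (real k) \<omega> N"
      unfolding final_config_def by (intro tendsto_Lim) auto
    then have "indicator ?F \<omega> = all_right N (\<xi> (real k) \<omega>)"
      using all_right_absorbed[OF k(1)] elim(2,3) by (simp add: indicator_def)
    moreover have "\<forall>\<^sub>F m in sequentially. all_right N (\<xi> (real m) \<omega>) = all_right N (\<xi> (real k) \<omega>)"
      using eventually_ge_at_top[of k] by eventually_elim (rule arg_cong[OF k(2)], simp)
    ultimately show ?case by (simp add: tendsto_eventually)
  qed
  have "(\<lambda>k. expectation (\<lambda>\<omega>. all_right N (\<xi> (real k) \<omega>))) \<longlonglongrightarrow> expectation (indicator ?F)"
  proof (rule integral_dominated_convergence[where w = "\<lambda>_. 1"])
    show "(\<lambda>\<omega>. all_right N (\<xi> (real k) \<omega>)) \<in> borel_measurable M" for k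
      by (rule borel_observable) simp
    show "AE \<omega> in M. norm (all_right N (\<xi> (real k) \<omega>)) \<le> 1" for k
      using range by (intro AE_I2) simp
  qed (use F lim in simp_all)
  moreover have "expectation (\<lambda>\<omega>. all_right N (\<xi> (real k) \<omega>)) = all_right N (indicator_config J)" for k
    by (rule martingale[OF bd]) (use generator_all_right[OF N] in auto)
  ultimately show ?thesis using F by (simp add: LIMSEQ_const_iff)
qed

end

theorem theorem1p4:
  fixes N n :: nat and x :: "nat \<Rightarrow> nat"
    and M :: "'a measure" and \<xi> :: "real \<Rightarrow> 'a \<Rightarrow> config"
  assumes "2 \<le> N"
    and "\<forall>i\<in>{1..n}. 1 \<le> x i \<and> x i \<le> N - 1"
    and "strict_mono_on {1..n} x"
    and "dual_exclusion_process N (segment_edges N)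
           (\<lambda>y z. if \<bar>int y - int z\<bar> = 1 then 1 else 0) 1 1 (x ` {1..n}) M \<xi>"
  shows "measure M {\<omega> \<in> space M. final_config \<xi> \<omega> N = n}
       = (\<Prod>i=1..n. (real (x i) - (real i - 1)) / (real N - (real i - 1)))"
proof -
  obtain P where P: "markov_process M (dual_configs N) P \<xi> (indicator_config (x ` {1..n}))"
    "has_generator (dual_configs N) P (dual_generator N (segment_edges N)
       (\<lambda>y z. if \<bar>int y - int z\<bar> = 1 then 1 else 0) 1 1)"
    using assms(4) unfolding dual_exclusion_process_def by blast
  interpret dual_segment N M P \<xi> "x ` {1..n}"
    by (intro dual_segment.intro dual_segment_axioms.intro P assms(1))
       (use assms(2) in \<open>auto simp: bulk_def\<close>)
  have card: "card (x ` {1..n}) = n"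
    by (subst card_image[OF strict_mono_on_imp_inj_on[OF assms(3)]]) simp
  show ?thesis
    using prob_all_right unfolding card all_right_indicator[OF assms(2,3)] .
qed

end
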